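(* Let $n\geq 1$ and let $K\subset(\mathbb{R}^{2n},\omega_0)$ be a convex body. Then $$c_{\rm EHZ}(K\times_L J_{2n}K)\leqslant 2\,c_{\rm EHZ}(K),$$ where the capacity on the left is taken in $\mathbb{R}^{2n}_q\times\mathbb{R}^{2n}_p=\mathbb{R}^{4n}$ with its standard symplectic form, and the capacity on the right is taken in $(\mathbb{R}^{2n},\omega_0)$.
   Context: Convex body: compact convex set with non-empty interior. Symplectic form and complex structure: for $m\ge1$, $\mathbb{R}^{2m}=\mathbb{R}^m_q\times\mathbb{R}^m_p$ carries the standard symplectic form $\omega((q,p),(q',p'))=\langle q,p'\rangle-\langle p,q'\rangle$ and the standard complex structure $J_{2m}(q,p)=(-p,q)$, so that $\langle x,y\rangle_{\mathbb{R}^{2m}}=\omega(x,J_{2m}y)$ with $\langle\cdot,\cdot\rangle_{\mathbb{R}^{2m}}$ the Euclidean inner product. On $\mathbb{R}^{2n}$ this form is denoted $\omega_0$. Lagrangian product: for $A,B\subset\mathbb{R}^{2n}$, $A\times_L B=\{(q,p)\in\mathbb{R}^{2n}\times\mathbb{R}^{2n} : q\in A,\ p\in B\}\subset\mathbb{R}^{4n}$, where $\mathbb{R}^{4n}=\mathbb{R}^{2n}_q\times\mathbb{R}^{2n}_p$ has the standard symplectic form $\tilde\omega_0((q,p),(q',p'))=\langle q,p'\rangle_{\mathbb{R}^{2n}}-\langle p,q'\rangle_{\mathbb{R}^{2n}}$. Here $J_{2n}K=\{J_{2n}x: x\in K\}$. Ekeland–Hofer–Zehnder capacity: for a convex body $C\subset(\mathbb{R}^{2m},\omega)$,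 $c_{\rm EHZ}(C)$ is the minimum of the action $A(\gamma)=\frac12\int_0^T\omega(\gamma(t),\dot\gamma(t))\,dt$ over all (generalized) closed characteristics on $\partial C$, i.e. non-constant absolutely continuous closed curves $\gamma:[0,T]\to\partial C$, $\gamma(0)=\gamma(T)$, with square-integrable derivative, such that $\dot\gamma(t)\in J_{2m}N_C(\gamma(t))$ for almost every $t$, where $N_C(x)=\{v:\langle v,y-x\rangle\le0\ \ \forall y\in C\}$ is the outer normal cone of $C$ at $x$. This coincides with the continuous extension (in the Hausdorff metric) to all convex bodies of the minimal action of closed characteristics on the boundary of smooth convex bodies. *)

theory Defs
  imports "HOL-Analysis.Analysis"
begin

text \<open>
  Phase space \<open>\<real>\<^sup>m\<^sub>q \<times> \<real>\<^sup>m\<^sub>p\<close> is the product type \<open>'a \<times> 'a\<close> over a Euclidean space \<open>'a\<close> of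
  dimension \<open>m\<close>; the inner product of a product type is the sum of the inner products of the
  components. Thus \<open>\<real>\<^sup>2\<^sup>n\<close> is \<open>(real^'n) \<times> (real^'n)\<close>, and \<open>\<real>\<^sup>4\<^sup>n = \<real>\<^sup>2\<^sup>n\<^sub>q \<times> \<real>\<^sup>2\<^sup>n\<^sub>p\<close> is
  \<open>((real^'n) \<times> (real^'n)) \<times> ((real^'n) \<times> (real^'n))\<close>.
\<close>

definition sympl_form :: "'a::real_inner \<times> 'a \<Rightarrow> 'a \<times> 'a \<Rightarrow> real" where
  "sympl_form x y = fst x \<bullet> snd y - snd x \<bullet> fst y"

definition cpx_J :: "'a::real_inner \<times> 'a \<Rightarrow> 'a \<times> 'a" where
  "cpx_J x = (- snd x, fst x)"

lemma inner_eq_sympl_form_cpx_J: "x \<bullet> y = sympl_form x (cpx_J y)"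
  by (simp add: sympl_form_def cpx_J_def inner_prod_def)

definition convex_body :: "'a::euclidean_space set \<Rightarrow> bool" where
  "convex_body C \<longleftrightarrow> compact C \<and> convex C \<and> interior C \<noteq> {}"

definition lagrangian_product :: "'a set \<Rightarrow> 'a set \<Rightarrow> ('a \<times> 'a) set"  (infixr \<open>\<times>\<^sub>L\<close> 80) where
  "A \<times>\<^sub>L B = {(q, p). q \<in> A \<and> p \<in> B}"

definition normal_cone :: "'a::real_inner set \<Rightarrow> 'a \<Rightarrow> 'a set" where
  "normal_cone C x = {v. \<forall>y\<in>C. v \<bullet> (y - x) \<le> 0}"

text \<open>
  The finite families of non-overlapping compact intervals are the divisions \<open>D division_of \<Union>D\<close>;
  a member \<open>I\<close> of such a family is \<open>{Inf I..Sup I}\<close>.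
\<close>

definition abs_continuous_on :: "real set \<Rightarrow> (real \<Rightarrow> 'a::real_normed_vector) \<Rightarrow> bool" where
  "abs_continuous_on S f \<longleftrightarrow>
     (\<forall>\<epsilon>>0. \<exists>\<delta>>0. \<forall>D. D division_of \<Union>D \<and> \<Union>D \<subseteq> S \<and> (\<Sum>I\<in>D. Sup I - Inf I) < \<delta> \<longrightarrow>
        (\<Sum>I\<in>D. norm (f (Sup I) - f (Inf I))) < \<epsilon>)"

text \<open>
  Only the restriction of \<open>\<gamma>\<close> to \<open>{0..T}\<close> matters. Being non-constant forces \<open>T > 0\<close>. Absolutely
  continuous curves are differentiable almost everywhere, so requiring the derivative to exist
  at almost every time adds nothing; it keeps the unspecified value of \<open>vector_derivative\<close> at
  exceptional times out of the inclusion.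
\<close>

abbreviation velocity :: "real \<Rightarrow> (real \<Rightarrow> 'a::real_normed_vector) \<Rightarrow> real \<Rightarrow> 'a" where
  "velocity T \<gamma> t \<equiv> vector_derivative \<gamma> (at t within {0..T})"

definition closed_characteristic ::
    "('a::euclidean_space \<times> 'a) set \<Rightarrow> real \<Rightarrow> (real \<Rightarrow> 'a \<times> 'a) \<Rightarrow> bool" where
  "closed_characteristic C T \<gamma> \<longleftrightarrow>
     \<gamma> ` {0..T} \<subseteq> frontier C \<and> \<gamma> 0 = \<gamma> T \<and> \<not> \<gamma> constant_on {0..T} \<and>
     abs_continuous_on {0..T} \<gamma> \<and>
     (\<lambda>t. (norm (velocity T \<gamma> t))\<^sup>2) absolutely_integrable_on {0..T} \<and>
     (AE t in lebesgue_on {0..T}. \<gamma> differentiable (at t within {0..T}) \<and>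
        velocity T \<gamma> t \<in> cpx_J ` normal_cone C (\<gamma> t))"

definition action :: "real \<Rightarrow> (real \<Rightarrow> 'a::euclidean_space \<times> 'a) \<Rightarrow> real" where
  "action T \<gamma> = 1 / 2 * (LINT t|lebesgue_on {0..T}. sympl_form (\<gamma> t) (velocity T \<gamma> t))"

text \<open>
  The capacity is the infimum, in the extended reals, of the actions of closed characteristics.
  Whenever the minimum is attained, as it is for every convex body, the capacity is that minimum.
\<close>

definition c_EHZ :: "('a::euclidean_space \<times> 'a) set \<Rightarrow> ereal" where
  "c_EHZ C = Inf {ereal (action T \<gamma>) | T \<gamma>. closed_characteristic C T \<gamma>}"

lemma c_EHZ_eq_minimum:
  assumes "closed_characteristic C T \<gamma>"
    and "\<And>T' \<gamma>'. closed_characteristic C T' \<gamma>' \<Longrightarrow> action T \<gamma> \<le> action T' \<gamma>'"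
  shows "c_EHZ C = ereal (action T \<gamma>)"
  unfolding c_EHZ_def using assms by (intro Inf_eqI) (auto, blast)

end

theory Submission
  imports Defs
begin

text \<open>
  If \<open>\<gamma>\<close> is a closed characteristic on the boundary of \<open>K\<close> and \<open>\<delta>\<close> is \<open>\<gamma>\<close> run backwards, then
  \<open>(\<delta>, J \<delta>)\<close> is a closed characteristic on the boundary of \<open>K \<times>\<^sub>L J K\<close> with exactly twice the action:
  the normal cone of \<open>K \<times>\<^sub>L J K\<close> at \<open>(x, J x)\<close> contains \<open>(u, J u)\<close> for every \<open>u\<close> normal to \<open>K\<close>
  at \<open>x\<close>, and the complex structure maps \<open>(u, J u)\<close> to \<open>(- J u, u) = - (J u, J (J u))\<close>. The minus
  sign is the reason for the time reversal.
\<close>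

section \<open>The graph of J: symplectic form, normal cone and frontier\<close>

definition J_graph :: "'a::real_inner \<times> 'a \<Rightarrow> ('a \<times> 'a) \<times> ('a \<times> 'a)" where
  "J_graph x = (x, cpx_J x)"

lemma cpx_J_cpx_J: "cpx_J (cpx_J x) = - x"
  by (simp add: cpx_J_def prod_eq_iff)

lemma norm_cpx_J: "norm (cpx_J x) = norm x"
  by (simp add: cpx_J_def norm_prod_def add.commute)

lemma inner_cpx_J_cpx_J: "cpx_J x \<bullet> cpx_J y = x \<bullet> y"
  by (simp add: cpx_J_def inner_prod_def)

lemma linear_cpx_J: "linear cpx_J"
  by (rule linearI) (simp_all add: cpx_J_def)

lemma linear_J_graph: "linear J_graph"
  by (rule linearI) (simp_all add: J_graph_def linear_add[OF linear_cpx_J] linear_cmul[OF linear_cpx_J])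

lemma norm_J_graph: "norm (J_graph x) = sqrt 2 * norm x"
  by (simp add: J_graph_def norm_Pair norm_cpx_J real_sqrt_mult flip: mult_2)

lemma sympl_form_J_graph: "sympl_form (J_graph x) (- J_graph v) = 2 * sympl_form x v"
  by (simp add: sympl_form_def J_graph_def cpx_J_def inner_prod_def inner_commute)

lemma cpx_J_J_graph: "cpx_J (J_graph u) = - J_graph (cpx_J u)"
  by (simp add: J_graph_def cpx_J_cpx_J) (simp add: cpx_J_def)

lemma lagrangian_product_eq_Times: "A \<times>\<^sub>L B = A \<times> B"
  by (auto simp: lagrangian_product_def)

text \<open>Pairing \<open>J_graph u\<close> with the difference of (y, Jz) and (x, Jx) gives u
  \<bullet> (y - x) + Ju \<bullet> (Jz - Jx). Since J is orthogonal, the second term is u \<bullet>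
  (z - x), so both are nonpositive.\<close>

lemma J_graph_in_normal_cone:
  assumes "u \<in> normal_cone K x"
  shows "J_graph u \<in> normal_cone (K \<times>\<^sub>L (cpx_J ` K)) (J_graph x)"
proof -
  have "cpx_J u \<bullet> (cpx_J y - cpx_J x) = u \<bullet> (y - x)" for y
    by (metis inner_cpx_J_cpx_J linear_cpx_J linear_diff)
  with assms show ?thesis
    by (fastforce simp: normal_cone_def lagrangian_product_eq_Times J_graph_def inner_prod_def
        intro: add_nonpos_nonpos)
qed

text \<open>Closure and interior commute with products. Both components lie in the closures of their
  factors, and the first one alone keeps the pair out of the interior.\<close>

lemma J_graph_in_frontier:
  fixes K :: "('a::euclidean_space \<times> 'a) set"
  assumes "x \<in> frontier K"
  shows "J_graph x \<in> frontier (K \<times>\<^sub>L (cpx_J ` K))"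
proof -
  have "cpx_J x \<in> closure (cpx_J ` K)"
    using assms closure_linear_image_subset[OF linear_cpx_J, of K] by (auto simp: frontier_def)
  with assms show ?thesis
    by (auto simp: frontier_def lagrangian_product_eq_Times J_graph_def closure_Times interior_Times)
qed

section \<open>Absolute continuity under time reversal and linear maps\<close>

lemma Inf_Sup_image_diff:
  fixes I :: "real set"
  assumes "I = {a..b}" "I \<noteq> {}"
  shows "Inf ((-) T ` I) = T - Sup I" and "Sup ((-) T ` I) = T - Inf I"
  using assms by auto

lemma division_of_image_diff:
  fixes D :: "real set set"
  assumes "D division_of S"
  shows "(`) ((-) T) ` D division_of (-) T ` S"
proof (rule division_ofI)
  note D = division_ofD[OF assms]
  have int: "interior ((-) T ` I) = (-) T ` interior I" for I :: "real set"
  proof -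
    \<comment> \<open>The reflection is a negation followed by a translation, and each of these
      commutes with \<open>interior\<close>.\<close>
    have eq: "(-) T ` A = (+) T ` uminus ` A" for A :: "real set"
      by (force simp: image_image)
    show ?thesis
      unfolding eq
      by (simp only: interior_translation interior_injective_linear_image[OF linear_uminus inj_uminus])
  qed
  show "finite ((`) ((-) T) ` D)" "\<Union> ((`) ((-) T) ` D) = (-) T ` S"
    using D by auto
  show "I \<subseteq> (-) T ` S" "I \<noteq> {}" if "I \<in> (`) ((-) T) ` D" for I
    using D that by auto
  show "\<exists>a b. I = cbox a b" if "I \<in> (`) ((-) T) ` D" for I
    using D(4) that by force
  show "interior I \<inter> interior L = {}"
    if IL: "I \<in> (`) ((-) T) ` D" "L \<in> (`) ((-) T) ` D" "I \<noteq> L" for I L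
  proof -
    obtain I' L' where "I' \<in> D" "L' \<in> D" "I = (-) T ` I'" "L = (-) T ` L'"
      using IL by blast
    moreover from this \<open>I \<noteq> L\<close> have "I' \<noteq> L'"
      by blast
    ultimately show ?thesis
      using D(5)[of I' L'] by (auto simp: int)
  qed
qed

text \<open>The same \<delta> serves: reflecting a division preserves the lengths of its intervals
  and swaps their endpoints, which only changes the signs of the increments.\<close>

lemma abs_continuous_on_reverse:
  assumes "abs_continuous_on {0..T} f"
  shows "abs_continuous_on {0..T} (\<lambda>t. f (T - t))"
  unfolding abs_continuous_on_def
proof (intro allI impI)
  fix e :: real
  assume "e > 0"
  with assms obtain d where "d > 0"
    and d: "\<And>D. D division_of \<Union>D \<Longrightarrow> \<Union>D \<subseteq> {0..T} \<Longrightarrow> (\<Sum>I\<in>D. Sup I - Inf I) < d \<Longrightarrow>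
      (\<Sum>I\<in>D. norm (f (Sup I) - f (Inf I))) < e"
    unfolding abs_continuous_on_def by meson
  show "\<exists>d>0. \<forall>D. D division_of \<Union>D \<and> \<Union>D \<subseteq> {0..T} \<and> (\<Sum>I\<in>D. Sup I - Inf I) < d \<longrightarrow>
      (\<Sum>I\<in>D. norm (f (T - Sup I) - f (T - Inf I))) < e"
  proof (intro exI[of _ d] conjI allI impI)
    fix D
    assume D: "D division_of \<Union>D \<and> \<Union>D \<subseteq> {0..T} \<and> (\<Sum>I\<in>D. Sup I - Inf I) < d"
    let ?D = "(`) ((-) T) ` D"
    have ends: "Inf ((-) T ` I) = T - Sup I" "Sup ((-) T ` I) = T - Inf I" if I: "I \<in> D" for I
    proof -
      obtain a b where "I = {a..b}" "I \<noteq> {}"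
        using division_ofD(3)[OF conjunct1[OF D] I] division_ofD(4)[OF conjunct1[OF D] I]
        by (metis box_real(2))
      then show "Inf ((-) T ` I) = T - Sup I" "Sup ((-) T ` I) = T - Inf I"
        by (rule Inf_Sup_image_diff)+
    qed
    have inj: "inj_on ((`) ((-) T)) D"
      by (rule inj_onI) (simp add: inj_image_eq_iff)
    have "?D division_of \<Union>?D"
      using division_of_image_diff[OF conjunct1[OF D], of T] by (simp add: image_Union)
    moreover have "\<Union>?D \<subseteq> {0..T}"
      using image_mono[OF conjunct1[OF conjunct2[OF D]], of "(-) T"] by (simp add: image_Union)
    moreover have "(\<Sum>I\<in>?D. Sup I - Inf I) = (\<Sum>I\<in>D. Sup I - Inf I)"
      by (subst sum.reindex[OF inj]) (simp add: ends)
    ultimately have "(\<Sum>I\<in>?D. norm (f (Sup I) - f (Inf I))) < e"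
      using D by (intro d) auto
    also have "(\<Sum>I\<in>?D. norm (f (Sup I) - f (Inf I))) = (\<Sum>I\<in>D. norm (f (T - Sup I) - f (T - Inf I)))"
      by (subst sum.reindex[OF inj]) (simp add: ends norm_minus_commute)
    finally show "(\<Sum>I\<in>D. norm (f (T - Sup I) - f (T - Inf I))) < e" .
  qed fact
qed

lemma abs_continuous_on_bounded_linear:
  assumes "bounded_linear h" and f: "abs_continuous_on S f"
  shows "abs_continuous_on S (\<lambda>t. h (f t))"
  unfolding abs_continuous_on_def
proof (intro allI impI)
  interpret bounded_linear h by fact
  obtain B where "B > 0" and B: "\<And>x. norm (h x) \<le> norm x * B"
    using pos_bounded by blast
  fix e :: real
  assume "e > 0"
  with \<open>B > 0\<close> have "e / B > 0" by simp
  with f obtain d where "d > 0"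
    and d: "\<And>D. D division_of \<Union>D \<and> \<Union>D \<subseteq> S \<and> (\<Sum>I\<in>D. Sup I - Inf I) < d \<Longrightarrow>
      (\<Sum>I\<in>D. norm (f (Sup I) - f (Inf I))) < e / B"
    unfolding abs_continuous_on_def by meson
  have "(\<Sum>I\<in>D. norm (h (f (Sup I)) - h (f (Inf I)))) < e"
    if "D division_of \<Union>D \<and> \<Union>D \<subseteq> S \<and> (\<Sum>I\<in>D. Sup I - Inf I) < d" for D
  proof -
    have "(\<Sum>I\<in>D. norm (h (f (Sup I)) - h (f (Inf I)))) \<le> (\<Sum>I\<in>D. norm (f (Sup I) - f (Inf I)) * B)"
      using B by (intro sum_mono) (simp flip: diff)
    also have "\<dots> < e"
      using d[OF that] \<open>B > 0\<close> unfolding sum_distrib_right[symmetric] by (simp add: field_simps)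
    finally show ?thesis .
  qed
  with \<open>d > 0\<close> show "\<exists>d>0. \<forall>D. D division_of \<Union>D \<and> \<Union>D \<subseteq> S \<and> (\<Sum>I\<in>D. Sup I - Inf I) < d \<longrightarrow>
      (\<Sum>I\<in>D. norm (h (f (Sup I)) - h (f (Inf I)))) < e"
    by blast
qed

section \<open>Null sets and integrals under time reversal\<close>

lemma AE_lebesgue_on_iff_negligible:
  fixes S :: "'a::euclidean_space set"
  assumes "S \<in> sets lebesgue"
  shows "(AE x in lebesgue_on S. P x) \<longleftrightarrow> (\<exists>N. negligible N \<and> (\<forall>x\<in>S - N. P x))"
proof -
  have "(AE x in lebesgue_on S. P x) \<longleftrightarrow> (AE x in lebesgue. x \<in> S \<longrightarrow> P x)"
    using assms by (subst AE_restrict_space_iff) auto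
  also have "\<dots> \<longleftrightarrow> (\<exists>N. negligible N \<and> (\<forall>x\<in>S - N. P x))"
    by (simp add: eventually_ae_filter Bex_def negligible_iff_null_sets subset_iff) blast
  finally show ?thesis .
qed

lemma negligible_image_diff:
  fixes N :: "real set"
  assumes "negligible N"
  shows "negligible ((-) T ` N)"
  using assms by (intro negligible_differentiable_image_negligible) (auto intro!: derivative_intros)

lemma AE_lebesgue_on_reverse:
  fixes T :: real
  assumes "AE t in lebesgue_on {0..T}. P t"
  shows "AE t in lebesgue_on {0..T}. P (T - t)"
proof -
  obtain N where "negligible N" and N: "\<forall>t\<in>{0..T} - N. P t"
    using assms by (auto simp: AE_lebesgue_on_iff_negligible)
  have "P (T - t)" if "t \<in> {0..T} - (-) T ` N" for t
    using N that by (force simp: image_iff)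
  with negligible_image_diff[OF \<open>negligible N\<close>] show ?thesis
    by (subst AE_lebesgue_on_iff_negligible) (simp, blast)
qed

text \<open>The \<open>else\<close> branch is the default value of the Bochner integral; the gauge
  integral may differ from 0 there. Covering this case lets the integral identities below hold for
  arbitrary integrands, so they apply directly to the action.\<close>

lemma integral_lebesgue_on_eq:
  fixes f :: "'a::euclidean_space \<Rightarrow> 'b::euclidean_space"
  assumes "S \<in> sets lebesgue"
  shows "integral\<^sup>L (lebesgue_on S) f = (if f absolutely_integrable_on S then integral S f else 0)"
proof -
  have "f absolutely_integrable_on S \<longleftrightarrow> integrable (lebesgue_on S) f"
    using assms by (simp add: set_integrable_def integrable_restrict_space)
  with assms show ?thesis
    by (simp add: lebesgue_integral_eq_integral not_integrable_integral_eq)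
qed

lemma integral_lebesgue_on_cong_AE:
  fixes f g :: "'a::euclidean_space \<Rightarrow> 'b::euclidean_space"
  assumes S: "S \<in> sets lebesgue" and "AE x in lebesgue_on S. f x = g x"
  shows "integral\<^sup>L (lebesgue_on S) f = integral\<^sup>L (lebesgue_on S) g"
proof -
  obtain N where N: "negligible N" "\<And>x. x \<in> S - N \<Longrightarrow> f x = g x"
    using assms by (auto simp: AE_lebesgue_on_iff_negligible)
  show ?thesis
    using absolutely_integrable_spike_eq[OF N] integral_spike[OF N]
    by (simp add: integral_lebesgue_on_eq[OF S])
qed

text \<open>As \<open_b> varies, this yields both the equivalence of integrability and the equality
  of the integrals.\<close>

lemma absolutely_integrable_on_reverse_integral:
  fixes f :: "real \<Rightarrow> real"
  shows "(\<lambda>t. f (T - t)) absolutely_integrable_on {0..T} \<and> integral {0..T} (\<lambda>t. f (T - t)) = b \<longleftrightarrow>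
    f absolutely_integrable_on {0..T} \<and> integral {0..T} f = b"
proof -
  \<comment> \<open>The factor is the absolute value of the derivative of the reflection, left
    unsimplified to match the change of variables rule.\<close>
  have "(\<lambda>t. \<bar>-1\<bar> * f (T - t)) absolutely_integrable_on {0..T} \<and>
      integral {0..T} (\<lambda>t. \<bar>-1\<bar> * f (T - t)) = b \<longleftrightarrow>
    f absolutely_integrable_on (-) T ` {0..T} \<and> integral ((-) T ` {0..T}) f = b"
    by (rule has_absolute_integral_change_of_variables_1')
      (auto intro!: derivative_eq_intros simp: inj_on_def)
  then show ?thesis
    by simp
qed

lemma absolutely_integrable_on_reverse:
  fixes f :: "real \<Rightarrow> real"
  shows "(\<lambda>t. f (T - t)) absolutely_integrable_on {0..T} \<longleftrightarrow> f absolutely_integrable_on {0..T}"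
  using absolutely_integrable_on_reverse_integral by blast

lemma integral_lebesgue_on_reverse:
  fixes f :: "real \<Rightarrow> real"
  shows "(LINT t|lebesgue_on {0..T}. f (T - t)) = (LINT t|lebesgue_on {0..T}. f t)"
  using absolutely_integrable_on_reverse_integral[where f = f and T = T] by (auto simp: integral_lebesgue_on_eq)

section \<open>The lifted, reversed characteristic and its action\<close>

lemma has_vector_derivative_linear_reverse:
  fixes \<gamma> :: "real \<Rightarrow> 'a::real_normed_vector"
  assumes "bounded_linear h" and "\<gamma> differentiable (at (T - t) within {0..T})"
  shows "((\<lambda>s. h (\<gamma> (T - s))) has_vector_derivative - h (velocity T \<gamma> (T - t))) (at t within {0..T})"
proof -
  \<comment> \<open>The reflection maps the interval onto itself; writing it as an image fits the
    chain rule for derivatives within sets.\<close>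
  have "(\<gamma> has_vector_derivative velocity T \<gamma> (T - t)) (at (T - t) within (-) T ` {0..T})"
    using assms(2) by (simp add: vector_derivative_works)
  moreover have "((-) T has_vector_derivative - 1) (at t within {0..T})"
    by (auto intro!: derivative_eq_intros)
  ultimately have "((\<gamma> \<circ> (-) T) has_vector_derivative - 1 *\<^sub>R velocity T \<gamma> (T - t)) (at t within {0..T})"
    by (intro vector_diff_chain_within)
  from bounded_linear.has_vector_derivative[OF assms(1) this] show ?thesis
    by (simp add: o_def bounded_linear.linear[OF assms(1)] linear_neg)
qed

lemma J_graph_reverse_closed_characteristic:
  fixes K :: "('a::euclidean_space \<times> 'a) set"
  assumes "closed_characteristic K T \<gamma>"
  defines "\<Gamma> \<equiv> \<lambda>t. J_graph (\<gamma> (T - t))"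
  shows "closed_characteristic (K \<times>\<^sub>L (cpx_J ` K)) T \<Gamma>"
    and "action T \<Gamma> = 2 * action T \<gamma>"
proof -
  have bl: "bounded_linear (J_graph :: 'a \<times> 'a \<Rightarrow> _)"
    by (simp add: linear_J_graph flip: linear_conv_bounded_linear)
  have fr: "\<gamma> ` {0..T} \<subseteq> frontier K" and cl: "\<gamma> 0 = \<gamma> T" and nc: "\<not> \<gamma> constant_on {0..T}"
    and ac: "abs_continuous_on {0..T} \<gamma>"
    and sq: "(\<lambda>t. (norm (velocity T \<gamma> t))\<^sup>2) absolutely_integrable_on {0..T}"
    and ae: "AE t in lebesgue_on {0..T}. \<gamma> differentiable (at t within {0..T}) \<and>
        velocity T \<gamma> t \<in> cpx_J ` normal_cone K (\<gamma> t)"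
    using assms(1) by (auto simp: closed_characteristic_def)
  \<comment> \<open>On a nondegenerate interval derivatives within it are unique, so
    \<open>velocity\<close> equals the derivative computed by the chain rule.\<close>
  have "T > 0"
  proof (rule ccontr)
    assume "\<not> 0 < T"
    then have "t = 0" if "t \<in> {0..T}" for t
      using that by simp
    then have "\<forall>t\<in>{0..T}. \<gamma> t = \<gamma> 0"
      by metis
    with nc show False
      unfolding constant_on_def by blast
  qed
  have vel: "\<Gamma> differentiable (at t within {0..T}) \<and> velocity T \<Gamma> t = - J_graph (velocity T \<gamma> (T - t))"
    if "\<gamma> differentiable (at (T - t) within {0..T})" "t \<in> {0..T}" for t
    using has_vector_derivative_linear_reverse[OF bl that(1)] \<open>T > 0\<close> that(2)
    unfolding \<Gamma>_def
    by (auto intro: differentiableI_vector vector_derivative_within_closed_interval)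
  have ae': "AE t in lebesgue_on {0..T}. t \<in> {0..T} \<and> \<gamma> differentiable (at (T - t) within {0..T}) \<and>
        velocity T \<gamma> (T - t) \<in> cpx_J ` normal_cone K (\<gamma> (T - t))"
    using AE_lebesgue_on_reverse[OF ae] by (auto simp: AE_lebesgue_on_iff_negligible)
  then have ae_vel: "AE t in lebesgue_on {0..T}. velocity T \<Gamma> t = - J_graph (velocity T \<gamma> (T - t))"
    by eventually_elim (use vel in blast)
  show "closed_characteristic (K \<times>\<^sub>L (cpx_J ` K)) T \<Gamma>"
    unfolding closed_characteristic_def
  proof (intro conjI)
    have "\<gamma> (T - t) \<in> frontier K" if "t \<in> {0..T}" for t
      using fr that by (simp add: image_subset_iff)
    then show "\<Gamma> ` {0..T} \<subseteq> frontier (K \<times>\<^sub>L (cpx_J ` K))"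
      unfolding \<Gamma>_def by (blast intro: J_graph_in_frontier)
    show "\<Gamma> 0 = \<Gamma> T"
      using cl by (simp add: \<Gamma>_def)
    show "\<not> \<Gamma> constant_on {0..T}"
    proof
      assume "\<Gamma> constant_on {0..T}"
      then obtain c where c: "\<Gamma> t = c" if "t \<in> {0..T}" for t
        by (auto simp: constant_on_def)
      have "\<gamma> t = fst c" if "t \<in> {0..T}" for t
        using c[of "T - t"] that by (auto simp: \<Gamma>_def J_graph_def)
      with nc show False
        by (auto simp: constant_on_def)
    qed
    show "abs_continuous_on {0..T} \<Gamma>"
      unfolding \<Gamma>_def by (intro abs_continuous_on_bounded_linear[OF bl] abs_continuous_on_reverse ac)
    obtain N where N: "negligible N"
      "\<forall>t\<in>{0..T} - N. velocity T \<Gamma> t = - J_graph (velocity T \<gamma> (T - t))"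
      using ae_vel by (auto simp: AE_lebesgue_on_iff_negligible)
    \<comment> \<open>The 2 is the square of the factor \<open>sqrt 2\<close> by which
      \<open>J_graph\<close> stretches norms.\<close>
    have "(\<lambda>t. 2 * (norm (velocity T \<gamma> (T - t)))\<^sup>2) absolutely_integrable_on {0..T}"
      using sq absolutely_integrable_on_reverse[of T "\<lambda>t. (norm (velocity T \<gamma> t))\<^sup>2"] by simp
    then show "(\<lambda>t. (norm (velocity T \<Gamma> t))\<^sup>2) absolutely_integrable_on {0..T}"
      by (rule absolutely_integrable_spike[OF _ N(1)]) (simp add: N(2) norm_J_graph power_mult_distrib)
    show "AE t in lebesgue_on {0..T}. \<Gamma> differentiable (at t within {0..T}) \<and>
        velocity T \<Gamma> t \<in> cpx_J ` normal_cone (K \<times>\<^sub>L (cpx_J ` K)) (\<Gamma> t)"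
      using ae'
    proof eventually_elim
      case (elim t)
      then obtain u where u: "u \<in> normal_cone K (\<gamma> (T - t))" "velocity T \<gamma> (T - t) = cpx_J u"
        by blast
      \<comment> \<open>The outer \<open>cpx_J\<close> is the complex structure of the doubled
        space; its sign absorbs the one from time reversal.\<close>
      have "velocity T \<Gamma> t = cpx_J (J_graph u)"
        using elim vel[of t] u(2) by (simp add: cpx_J_J_graph)
      with elim vel[of t] J_graph_in_normal_cone[OF u(1)] show ?case
        by (auto simp: \<Gamma>_def)
    qed
  qed
  have "(LINT t|lebesgue_on {0..T}. sympl_form (\<Gamma> t) (velocity T \<Gamma> t)) =
      (LINT t|lebesgue_on {0..T}. 2 * sympl_form (\<gamma> (T - t)) (velocity T \<gamma> (T - t)))"
    by (rule integral_lebesgue_on_cong_AE, simp)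
      (use ae_vel in eventually_elim, simp add: \<Gamma>_def sympl_form_J_graph)
  also have "\<dots> = 2 * (LINT t|lebesgue_on {0..T}. sympl_form (\<gamma> t) (velocity T \<gamma> t))"
    using integral_lebesgue_on_reverse[of T "\<lambda>t. sympl_form (\<gamma> t) (velocity T \<gamma> t)"] by simp
  finally show "action T \<Gamma> = 2 * action T \<gamma>"
    by (simp add: action_def)
qed

theorem theorem1p1:
  fixes K :: "((real ^ 'n) \<times> (real ^ 'n)) set"
  assumes "convex_body K"
  shows "c_EHZ (K \<times>\<^sub>L (cpx_J ` K)) \<le> 2 * c_EHZ K"
proof -
  \<comment> \<open>With the 2 moved to the left, the claim says that a fixed number bounds every
    action in the infimum from below.\<close>
  have "c_EHZ (K \<times>\<^sub>L (cpx_J ` K)) / 2 \<le> c_EHZ K"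
    unfolding c_EHZ_def[of K]
  proof (rule Inf_greatest, clarify)
    fix T \<gamma>
    assume \<gamma>: "closed_characteristic K T \<gamma>"
    have "c_EHZ (K \<times>\<^sub>L (cpx_J ` K)) \<le> ereal (2 * action T \<gamma>)"
      using J_graph_reverse_closed_characteristic[OF \<gamma>] unfolding c_EHZ_def
      by (intro Inf_lower) (auto, metis)
    then show "c_EHZ (K \<times>\<^sub>L (cpx_J ` K)) / 2 \<le> ereal (action T \<gamma>)"
      by (simp add: ereal_divide_le_pos)
  qed
  then show ?thesis
    by (simp add: ereal_divide_le_pos)
qed

end
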